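(* Let $(\mathbb{X},d,\mu)$ be a proper, geodesic metric measure space satisfying the $\delta$-annular decay property for some $\delta\in(0,1]$, and let $\Omega\subset\mathbb{X}$ be a bounded domain. Let $\varrho$ be an admissible radius function in $\Omega$ which is Lipschitz with constant $L\geq 1$, i.e. $|\varrho(x)-\varrho(y)|\leq L\,d(x,y)$ for all $x,y\in\Omega$, and such that $$\lambda\,\mathrm{dist}(x,\partial\Omega)^\beta\leq\varrho(x)\leq\varepsilon\,\mathrm{dist}(x,\partial\Omega)\quad\text{for all }x\in\Omega,$$ where $0<\lambda\leq \ell(\Omega)^{1-\beta}\varepsilon$. Let $\alpha\in\mathbb{R}$ and assume $|\alpha|<L^{-1}$, $0<\varepsilon<1-L|\alpha|$ and $$1\leq\beta<\frac{\log\frac{1}{L|\alpha|}}{\log\frac{1}{1-\varepsilon}}$$ (the right-hand side being $+\infty$ if $\alpha=0$). Then every $u\in C(\overline{\Omega})$ satisfying $\mathcal{T}_\alpha u(x)=u(x)$ for all $x\in\Omega$ is locally $\delta$-H\"older continuous in $\Omega$. In particular, if $\delta=1$ then $u$ is locally Lipschitz continuous in $\Omega$.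
   Context: A metric space is proper if closed bounded sets are compact, and geodesic if any two points $x,y$ are joined by a curve of length $d(x,y)$. A metric measure space $(\mathbb{X},d,\mu)$ is a metric space with a positive Borel regular measure $\mu$ with $0<\mu(B)<\infty$ for every ball $B$. It satisfies the $\delta$-annular decay property ($\delta\in(0,1]$) if there is $D_\delta\geq1$ with $\mu(B(x,R)\setminus B(x,r))\leq D_\delta\left(\frac{R-r}{R}\right)^\delta\mu(B(x,R))$ for all $x\in\mathbb{X}$, $0<r\leq R$. For a bounded domain $\Omega$, $\ell(\Omega)=\sup_{x\in\Omega}\mathrm{dist}(x,\partial\Omega)$. An admissible radius function in $\Omega$ is a function $\varrho\in C(\overline\Omega)$, $\varrho\ge0$, with $0<\varrho(x)\leq\mathrm{dist}(x,\partial\Omega)$ for $x\in\Omega$ and $\varrho(x)=0$ iff $x\in\partial\Omega$. For $x\in\Omega$ let $B_x=\overline{B}(x,\varrho(x))$ be the closed ball. For $u\in C(\overline\Omega)$, $x\in\Omega$, $\alpha\in\mathbb{R}$: $\mathcal{M}u(x)=\frac{1}{\mu(B_x)}\int_{B_x}u\,d\mu$, $\mathcal{S}u(x)=\frac12\left(\sup_{B_x}u+\inf_{B_x}u\right)$, $\mathcal{T}_\alpha u(x)=\alpha\,\mathcal{S}u(x)+(1-\alpha)\mathcal{M}u(x)$. Locally $\delta$-H\"older continuous in $\Omega$ means: for every compact $K\subset\Omega$ there is $C$ with $|u(x)-u(y)|\leq C\,d(x,y)^\delta$ for all $x,y\in K$. *)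

theory Defs
  imports "HOL-Analysis.Analysis"
begin

definition proper_space :: "'a::metric_space itself \<Rightarrow> bool" where
  "proper_space _ \<longleftrightarrow> (\<forall>S::'a set. closed S \<and> bounded S \<longrightarrow> compact S)"

definition curve_length :: "(real \<Rightarrow> 'a::metric_space) \<Rightarrow> real \<Rightarrow> real \<Rightarrow> ereal" where
  "curve_length \<gamma> a b =
     (SUP p \<in> {(n::nat, t::nat \<Rightarrow> real). t 0 = a \<and> t n = b \<and> (\<forall>i<n. t i \<le> t (Suc i))}.
        ereal (\<Sum>i<fst p. dist (\<gamma> (snd p i)) (\<gamma> (snd p (Suc i)))))"

definition geodesic_space :: "'a::metric_space itself \<Rightarrow> bool" where
  "geodesic_space _ \<longleftrightarrow> (\<forall>x y::'a. \<exists>\<gamma> a b. a \<le> b \<and> continuous_on {a..b} \<gamma> \<and>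
      \<gamma> a = x \<and> \<gamma> b = y \<and> curve_length \<gamma> a b = ereal (dist x y))"

definition mm_space :: "'a::metric_space measure \<Rightarrow> bool" where
  "mm_space \<mu> \<longleftrightarrow> sets \<mu> = sets borel \<and>
     (\<forall>x r. r > 0 \<longrightarrow> 0 < emeasure \<mu> (ball x r) \<and> emeasure \<mu> (ball x r) < \<infinity>)"

definition annular_decay :: "'a::metric_space measure \<Rightarrow> real \<Rightarrow> bool" where
  "annular_decay \<mu> \<delta> \<longleftrightarrow> (\<exists>D\<ge>1. \<forall>x r R. 0 < r \<and> r \<le> R \<longrightarrow>
     measure \<mu> (ball x R - ball x r) \<le> D * ((R - r) / R) powr \<delta> * measure \<mu> (ball x R))"

definition domain :: "'a::topological_space set \<Rightarrow> bool" where
  "domain \<Omega> \<longleftrightarrow> open \<Omega> \<and> connected \<Omega> \<and> \<Omega> \<noteq> {}"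

definition inradius :: "'a::metric_space set \<Rightarrow> real" where
  "inradius \<Omega> = (SUP x\<in>\<Omega>. infdist x (frontier \<Omega>))"

definition admissible_radius :: "'a::metric_space set \<Rightarrow> ('a \<Rightarrow> real) \<Rightarrow> bool" where
  "admissible_radius \<Omega> \<rho> \<longleftrightarrow> continuous_on (closure \<Omega>) \<rho> \<and>
     (\<forall>x\<in>closure \<Omega>. \<rho> x \<ge> 0) \<and>
     (\<forall>x\<in>\<Omega>. 0 < \<rho> x \<and> \<rho> x \<le> infdist x (frontier \<Omega>)) \<and>
     (\<forall>x\<in>closure \<Omega>. \<rho> x = 0 \<longleftrightarrow> x \<in> frontier \<Omega>)"

definition mean_op :: "'a::metric_space measure \<Rightarrow> ('a \<Rightarrow> real) \<Rightarrow> ('a \<Rightarrow> real) \<Rightarrow> 'a \<Rightarrow> real" where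
  "mean_op \<mu> \<rho> u x = (LINT y:cball x (\<rho> x)|\<mu>. u y) / measure \<mu> (cball x (\<rho> x))"

definition midrange_op :: "('a::metric_space \<Rightarrow> real) \<Rightarrow> ('a \<Rightarrow> real) \<Rightarrow> 'a \<Rightarrow> real" where
  "midrange_op \<rho> u x = (Sup (u ` cball x (\<rho> x)) + Inf (u ` cball x (\<rho> x))) / 2"

definition T_op :: "real \<Rightarrow> 'a::metric_space measure \<Rightarrow> ('a \<Rightarrow> real) \<Rightarrow> ('a \<Rightarrow> real) \<Rightarrow> 'a \<Rightarrow> real" where
  "T_op \<alpha> \<mu> \<rho> u x = \<alpha> * midrange_op \<rho> u x + (1 - \<alpha>) * mean_op \<mu> \<rho> u x"

definition locally_holder_on :: "real \<Rightarrow> 'a::metric_space set \<Rightarrow> ('a \<Rightarrow> real) \<Rightarrow> bool" where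
  "locally_holder_on \<delta> \<Omega> u \<longleftrightarrow> (\<forall>K. compact K \<and> K \<subseteq> \<Omega> \<longrightarrow>
     (\<exists>C. \<forall>x\<in>K. \<forall>y\<in>K. \<bar>u x - u y\<bar> \<le> C * dist x y powr \<delta>))"

end

theory Submission
  imports Defs
begin

text \<open>The annular decay makes the mean \<open>\<delta>\<close>-Hoelder, with a constant of order
  \<open>dist(x, frontier \<Omega>) powr (- \<beta> * \<delta>)\<close>. On a geodesic space the midrange turns an oscillation bound
  \<open>a + b * d powr \<delta>\<close> into \<open>a + b * (L * d) powr \<delta>\<close>, at the price of approaching the frontier by a
  factor \<open>1 - \<epsilon>\<close>. Iterating \<open>u = T_op \<alpha> \<mu> \<rho> u\<close> from the trivial bound \<open>2 * sup \<bar>u\<bar>\<close>, each step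
  multiplies the constant part by \<open>\<bar>\<alpha>\<bar>\<close>, while the Hoelder constants stay bounded since
  \<open>\<bar>\<alpha>\<bar> * L powr \<delta> * (1 - \<epsilon>) powr (- \<beta> * \<delta>) < 1\<close>; in the limit only the Hoelder part survives.\<close>

section \<open>Geodesics and balls\<close>

text \<open>The partition \<open>a\<close>, \<open>t\<close>, \<open>b\<close> is admissible in the
  supremum defining the length, so the two chords through \<open>\<gamma> t\<close> together are no
  longer than the curve, which has length \<open>dist x y\<close>. This is the form in which
  geodesicity enters everything below.\<close>

lemma geodesic_space_between:
  fixes x y :: "'a::metric_space"
  assumes "geodesic_space TYPE('a)"
  obtains \<gamma> :: "real \<Rightarrow> 'a" and a b where "a \<le> b" "continuous_on {a..b} \<gamma>" "\<gamma> a = x" "\<gamma> b = y"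
    "\<And>t. t \<in> {a..b} \<Longrightarrow> dist x (\<gamma> t) + dist (\<gamma> t) y \<le> dist x y"
proof -
  obtain \<gamma> a b where \<gamma>: "a \<le> b" "continuous_on {a..b} \<gamma>" "\<gamma> a = x" "\<gamma> b = y"
    and len: "curve_length \<gamma> a b = ereal (dist x y)"
    using assms unfolding geodesic_space_def by blast
  have "dist x (\<gamma> t) + dist (\<gamma> t) y \<le> dist x y" if t: "t \<in> {a..b}" for t
  proof -
    define p where "p = (2::nat, \<lambda>i::nat. if i = 0 then a else if i = 1 then t else b)"
    have "p \<in> {(n::nat, t::nat \<Rightarrow> real). t 0 = a \<and> t n = b \<and> (\<forall>i<n. t i \<le> t (Suc i))}"
      using t by (auto simp: p_def)
    then have "ereal (\<Sum>i<fst p. dist (\<gamma> (snd p i)) (\<gamma> (snd p (Suc i)))) \<le> curve_length \<gamma> a b"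
      unfolding curve_length_def by (rule SUP_upper)
    then show ?thesis
      using len \<gamma> by (simp add: p_def numeral_2_eq_2)
  qed
  then show thesis
    using that \<gamma> by blast
qed

text \<open>Walking from \<open>y\<close> along a geodesic towards \<open>z\<close>, the
  intermediate value theorem gives a point at distance exactly \<open>s\<close>, and at most
  \<open>dist y z - s\<close> remains. If \<open>z\<close> is already in the ball, \<open>z\<close>
  itself serves; hence the \<open>max 0\<close>.\<close>

lemma geodesic_space_point_on_ball:
  fixes y z :: "'a::metric_space"
  assumes "geodesic_space TYPE('a)" and "0 \<le> s"
  obtains w where "w \<in> cball y s" "dist w z \<le> max 0 (dist y z - s)"
proof (cases "dist y z \<le> s")
  case True
  then show thesis
    using that[of z] by simp
next
  case False
  obtain \<gamma> and a b :: real where \<gamma>: "a \<le> b" "continuous_on {a..b} \<gamma>" "\<gamma> a = y" "\<gamma> b = z"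
    and between: "\<And>t. t \<in> {a..b} \<Longrightarrow> dist y (\<gamma> t) + dist (\<gamma> t) z \<le> dist y z"
    by (rule geodesic_space_between[OF assms(1), of y z]) blast
  have "\<exists>t. a \<le> t \<and> t \<le> b \<and> dist y (\<gamma> t) = s"
    by (rule IVT') (use \<gamma> False assms(2) in \<open>auto intro!: continuous_intros\<close>)
  then obtain t where "t \<in> {a..b}" "dist y (\<gamma> t) = s"
    by auto
  with between[of t] show thesis
    using that[of "\<gamma> t"] by auto
qed

text \<open>A geodesic from \<open>x\<close> to a point outside \<open>\<Omega>\<close> is
  connected, so it meets the frontier, and it does so no farther from \<open>x\<close> than its
  endpoint.\<close>

lemma geodesic_space_cball_subset:
  fixes x :: "'a::metric_space"
  assumes "geodesic_space TYPE('a)" and "x \<in> \<Omega>" and "r < infdist x (frontier \<Omega>)"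
  shows "cball x r \<subseteq> \<Omega>"
proof
  fix z assume z: "z \<in> cball x r"
  obtain \<gamma> and a b :: real where \<gamma>: "a \<le> b" "continuous_on {a..b} \<gamma>" "\<gamma> a = x" "\<gamma> b = z"
    and between: "\<And>t. t \<in> {a..b} \<Longrightarrow> dist x (\<gamma> t) + dist (\<gamma> t) z \<le> dist x z"
    by (rule geodesic_space_between[OF assms(1), of x z]) blast
  show "z \<in> \<Omega>"
  proof (rule ccontr)
    assume "z \<notin> \<Omega>"
    moreover have "x \<in> \<gamma> ` {a..b}" "z \<in> \<gamma> ` {a..b}"
      using \<gamma> by auto
    moreover have "connected (\<gamma> ` {a..b})"
      using \<gamma> by (intro connected_continuous_image) auto
    ultimately have "\<gamma> ` {a..b} \<inter> frontier \<Omega> \<noteq> {}"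
      using assms(2) by (intro connected_Int_frontier) auto
    then obtain t where t: "t \<in> {a..b}" "\<gamma> t \<in> frontier \<Omega>"
      by blast
    have "infdist x (frontier \<Omega>) \<le> dist x (\<gamma> t)"
      using t by (intro infdist_le)
    also have "\<dots> \<le> dist x z"
      using between[OF t(1)] zero_le_dist[of "\<gamma> t" z] by linarith
    finally show False
      using z assms(3) by simp
  qed
qed

section \<open>Averages over balls and annular decay\<close>

lemma set_integrable_bounded:
  fixes v :: "'a \<Rightarrow> real"
  assumes "A \<in> sets M" "emeasure M A < \<infinity>" "v \<in> borel_measurable M" "\<And>x. \<bar>v x\<bar> \<le> c"
  shows "set_integrable M A v"
  unfolding set_integrable_def
proof (rule Bochner_Integration.integrable_bound)
  show "integrable M (\<lambda>x. c * indicator A x :: real)"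
    using assms by simp
  show "AE x in M. norm (indicator A x *\<^sub>R v x) \<le> norm (c * indicator A x :: real)"
    using order.trans[OF assms(4) abs_ge_self] by (auto simp: indicator_def)
qed (use assms in measurable)

lemma abs_set_integral_bounded:
  fixes v :: "'a \<Rightarrow> real"
  assumes "A \<in> sets M" "emeasure M A < \<infinity>" "v \<in> borel_measurable M" "\<And>x. \<bar>v x\<bar> \<le> c"
  shows "\<bar>LINT x:A|M. v x\<bar> \<le> c * measure M A"
proof -
  have "\<bar>LINT x:A|M. v x\<bar> \<le> (LINT x|M. \<bar>indicator A x *\<^sub>R v x\<bar>)"
    unfolding set_lebesgue_integral_def by (rule integral_abs_bound)
  also have "\<dots> \<le> (LINT x|M. c * indicator A x)"
  proof (rule integral_mono)
    show "integrable M (\<lambda>x. \<bar>indicator A x *\<^sub>R v x\<bar>)"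
      using set_integrable_bounded[OF assms] unfolding set_integrable_def by (rule integrable_abs)
    show "integrable M (\<lambda>x. c * indicator A x :: real)"
      using assms by simp
    show "\<bar>indicator A x *\<^sub>R v x\<bar> \<le> c * indicator A x" for x
      using assms(4) by (auto simp: indicator_def)
  qed
  also have "\<dots> = c * measure M A"
    using assms(1) by simp
  finally show ?thesis .
qed

text \<open>With \<open>I\<close> and \<open>J\<close> the integrals over \<open>A\<close> and
  \<open>B - A\<close>, and \<open>a\<close>, \<open>b\<close> the measures of \<open>A\<close> and
  \<open>B\<close>, the difference equals \<open>(I / a) * ((b - a) / b) - J / b\<close>. Each of
  the two terms is at most \<open>c * ((b - a) / b)\<close> in absolute value, which explains the
  factor 2.\<close>

lemma abs_diff_average_subset_le:
  fixes v :: "'a \<Rightarrow> real"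
  assumes AB: "A \<subseteq> B" "A \<in> sets M" "B \<in> sets M" and B: "emeasure M B < \<infinity>" and A: "0 < measure M A"
    and v: "v \<in> borel_measurable M" "\<And>x. \<bar>v x\<bar> \<le> c"
  shows "\<bar>(LINT x:A|M. v x) / measure M A - (LINT x:B|M. v x) / measure M B\<bar>
    \<le> 2 * c * measure M (B - A) / measure M B"
proof -
  define a b where "a = measure M A" and "b = measure M B"
  define I J where "I = (LINT x:A|M. v x)" and "J = (LINT x:B - A|M. v x)"
  have fin: "emeasure M A < \<infinity>" "emeasure M (B - A) < \<infinity>"
    using AB B by (meson Diff_subset emeasure_mono le_less_trans)+
  have meas: "measure M (B - A) = b - a"
    unfolding a_def b_def using AB B by (intro measure_Diff) auto
  have "a > 0" "a \<le> b"
    using A measure_nonneg[of M "B - A"] meas by (auto simp: a_def)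
  have I: "\<bar>I\<bar> \<le> c * a"
    unfolding I_def a_def using AB fin v by (intro abs_set_integral_bounded)
  have J: "\<bar>J\<bar> \<le> c * (b - a)"
    unfolding J_def meas[symmetric] using AB fin v by (intro abs_set_integral_bounded) auto
  have "(LINT x:A \<union> (B - A)|M. v x) = I + J"
    unfolding I_def J_def
    using AB fin v by (intro set_integral_Un set_integrable_bounded[of _ _ _ c]) auto
  moreover have "A \<union> (B - A) = B"
    using AB by auto
  ultimately have B_eq: "(LINT x:B|M. v x) = I + J"
    by simp
  have "I / a - (I + J) / b = (I / a) * ((b - a) / b) - J / b"
    using \<open>a > 0\<close> \<open>a \<le> b\<close> by (simp add: field_simps)
  moreover have "\<bar>(I / a) * ((b - a) / b)\<bar> \<le> c * ((b - a) / b)"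
    using I \<open>a > 0\<close> \<open>a \<le> b\<close> unfolding abs_mult
    by (intro mult_mono) (auto simp: field_simps intro: order.trans[OF abs_ge_zero v(2)])
  moreover have "\<bar>J / b\<bar> \<le> c * ((b - a) / b)"
    using J \<open>a > 0\<close> \<open>a \<le> b\<close> by (simp add: field_simps)
  ultimately have "\<bar>I / a - (I + J) / b\<bar> \<le> 2 * (c * ((b - a) / b))"
    by linarith
  then show ?thesis
    by (simp add: B_eq meas a_def[symmetric] b_def[symmetric] I_def[symmetric])
qed

text \<open>For \<open>r \<le> 0\<close> the inner ball is empty and the ratio is at least 1, so
  \<open>D \<ge> 1\<close> suffices. The case arises because the inner radius
  \<open>\<rho> x - (2 + L) * dist x y\<close> used below is negative when the centres are far apart
  relative to \<open>\<rho> x\<close>.\<close>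

lemma annular_decay_any_inner_radius:
  fixes x :: "'a::metric_space"
  assumes "D \<ge> 1" "0 < \<delta>"
    and decay: "\<And>x r R. 0 < r \<Longrightarrow> r \<le> R \<Longrightarrow>
      measure \<mu> (ball x R - ball x r) \<le> D * ((R - r) / R) powr \<delta> * measure \<mu> (ball x R)"
    and "0 < R" "r \<le> R"
  shows "measure \<mu> (ball x R - ball x r) \<le> D * ((R - r) / R) powr \<delta> * measure \<mu> (ball x R)"
proof (cases "0 < r")
  case False
  then have "1 \<le> ((R - r) / R) powr \<delta>"
    using assms by (intro ge_one_powr_ge_zero) (auto simp: field_simps)
  then have "1 * 1 \<le> D * ((R - r) / R) powr \<delta>"
    using \<open>D \<ge> 1\<close> by (intro mult_mono) auto
  then have "1 * measure \<mu> (ball x R) \<le> D * ((R - r) / R) powr \<delta> * measure \<mu> (ball x R)"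
    by (intro mult_right_mono) auto
  moreover have "ball x R - ball x r = ball x R"
    using False by (simp add: ball_empty)
  ultimately show ?thesis
    by simp
qed (use decay assms in blast)

text \<open>Both balls lie between two concentric balls around \<open>x\<close> of radii \<open>\<rho> x \<mp> (2 + L) * dist x y\<close>,
  so both means are compared with the mean over the larger of these.\<close>

lemma abs_mean_op_diff_le:
  fixes x y :: "'a::metric_space"
  assumes mm: "mm_space \<mu>" and D: "D \<ge> 1" "0 < \<delta>"
    and decay: "\<And>x r R. 0 < r \<Longrightarrow> r \<le> R \<Longrightarrow>
      measure \<mu> (ball x R - ball x r) \<le> D * ((R - r) / R) powr \<delta> * measure \<mu> (ball x R)"
    and u: "closed F" "continuous_on F u" "\<And>z. z \<in> F \<Longrightarrow> \<bar>u z\<bar> \<le> M" "0 \<le> M"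
    and sub: "cball x (\<rho> x) \<subseteq> F" "cball y (\<rho> y) \<subseteq> F"
    and \<rho>: "0 < \<rho> x" "0 < \<rho> y" "\<bar>\<rho> x - \<rho> y\<bar> \<le> L * dist x y" "0 \<le> L" and "x \<noteq> y"
  shows "\<bar>mean_op \<mu> \<rho> u x - mean_op \<mu> \<rho> u y\<bar>
    \<le> 4 * M * D * (2 * (2 + L)) powr \<delta> * (dist x y / \<rho> x) powr \<delta>"
proof -
  define d where "d = dist x y"
  \<comment> \<open>Continuity and the bound \<open>M\<close> are known only on \<open>F\<close>.
    Cutting off by zero gives a Borel function bounded by \<open>M\<close> everywhere, which can be
    averaged over \<open>ball x R\<close> even where that ball leaves \<open>F\<close>.\<close>
  define v where "v z = indicator F z *\<^sub>R u z" for z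
  define R s where "R = \<rho> x + (2 + L) * d" and "s = \<rho> x - (2 + L) * d"
  have d: "d > 0"
    using \<open>x \<noteq> y\<close> by (simp add: d_def)
  have "0 < (2 + L) * d"
    using d \<open>0 \<le> L\<close> by simp
  then have R: "0 < R" "\<rho> x < R" "s \<le> R" "s < \<rho> x"
    using \<rho> unfolding R_def s_def by linarith+
  have sets: "sets \<mu> = sets borel"
    using mm by (simp add: mm_space_def)
  have v: "v \<in> borel_measurable \<mu>" "\<bar>v z\<bar> \<le> M" for z
    using u borel_measurable_continuous_on_indicator[of F u]
    by (auto simp: v_def[abs_def] indicator_def measurable_cong_sets[OF sets refl])
  have fin: "emeasure \<mu> (ball x R) < \<infinity>"
    using mm R by (auto simp: mm_space_def)
  have meas_pos: "0 < measure \<mu> (ball x R)"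
    using mm R by (auto simp: mm_space_def measure_def enn2real_positive_iff)
  have est: "\<bar>mean_op \<mu> \<rho> u w - (LINT z:ball x R|\<mu>. v z) / measure \<mu> (ball x R)\<bar>
      \<le> 2 * M * D * ((R - s) / R) powr \<delta>"
    if "cball w (\<rho> w) \<subseteq> F" "0 < \<rho> w" "cball w (\<rho> w) \<subseteq> ball x R" "ball x s \<subseteq> cball w (\<rho> w)" for w
  proof -
    have fin_w: "emeasure \<mu> (cball w (\<rho> w)) < \<infinity>"
      using emeasure_mono[OF that(3), of \<mu>] fin sets by (auto intro: le_less_trans)
    have "0 < emeasure \<mu> (ball w (\<rho> w))"
      using mm that(2) by (simp add: mm_space_def)
    also have "\<dots> \<le> emeasure \<mu> (cball w (\<rho> w))"
      using sets by (intro emeasure_mono) auto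
    finally have pos_w: "0 < measure \<mu> (cball w (\<rho> w))"
      using fin_w by (auto simp: measure_def enn2real_positive_iff)
    have "(LINT z:cball w (\<rho> w)|\<mu>. u z) = (LINT z:cball w (\<rho> w)|\<mu>. v z)"
      using that(1) sets by (intro set_lebesgue_integral_cong) (auto simp: v_def)
    then have "\<bar>mean_op \<mu> \<rho> u w - (LINT z:ball x R|\<mu>. v z) / measure \<mu> (ball x R)\<bar>
        \<le> 2 * M * measure \<mu> (ball x R - cball w (\<rho> w)) / measure \<mu> (ball x R)"
      unfolding mean_op_def
      using that sets fin pos_w v by (simp only:) (intro abs_diff_average_subset_le, auto)
    also have "\<dots> \<le> 2 * M * (D * ((R - s) / R) powr \<delta> * measure \<mu> (ball x R)) / measure \<mu> (ball x R)"
    proof (intro divide_right_mono mult_left_mono)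
      have "measure \<mu> (ball x R - cball w (\<rho> w)) \<le> measure \<mu> (ball x R - ball x s)"
        using that sets fin emeasure_mono[of "ball x R - ball x s" "ball x R" \<mu>]
        by (intro measure_mono_fmeasurable fmeasurableI) (auto intro: le_less_trans)
      also have "\<dots> \<le> D * ((R - s) / R) powr \<delta> * measure \<mu> (ball x R)"
        by (rule annular_decay_any_inner_radius[OF D decay]) (use R in auto)
      finally show "measure \<mu> (ball x R - cball w (\<rho> w))
        \<le> D * ((R - s) / R) powr \<delta> * measure \<mu> (ball x R)" .
    qed (use u in auto)
    also have "\<dots> = 2 * M * D * ((R - s) / R) powr \<delta>"
      using meas_pos by simp
    finally show ?thesis .
  qed
  have x: "cball x (\<rho> x) \<subseteq> ball x R" "ball x s \<subseteq> cball x (\<rho> x)"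
    using R by auto
  have y: "cball y (\<rho> y) \<subseteq> ball x R" "ball x s \<subseteq> cball y (\<rho> y)"
  proof -
    \<comment> \<open>Of the width \<open>(2 + L) * d\<close>, one \<open>d\<close> pays for moving
      the centre and \<open>L * d\<close> for the change of radius; the last \<open>d\<close> makes
      the inequalities strict.\<close>
    have *: "\<rho> y + d < R" "s + d < \<rho> y"
      using \<rho>(3) d unfolding R_def s_def d_def[symmetric] by (auto simp: algebra_simps abs_le_iff)
    show "cball y (\<rho> y) \<subseteq> ball x R"
    proof
      fix z assume "z \<in> cball y (\<rho> y)"
      then show "z \<in> ball x R"
        using * dist_triangle[of x z y] by (simp add: d_def)
    qed
    show "ball x s \<subseteq> cball y (\<rho> y)"
    proof
      fix z assume "z \<in> ball x s"
      then show "z \<in> cball y (\<rho> y)"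
        using * dist_triangle[of y z x] by (simp add: d_def dist_commute)
    qed
  qed
  have "\<bar>mean_op \<mu> \<rho> u x - mean_op \<mu> \<rho> u y\<bar> \<le> 4 * M * D * ((R - s) / R) powr \<delta>"
    using est[OF sub(1) \<rho>(1) x] est[OF sub(2) \<rho>(2) y] by linarith
  also have "\<dots> \<le> 4 * M * D * ((2 * (2 + L)) * (d / \<rho> x)) powr \<delta>"
  proof (intro mult_left_mono powr_mono2)
    \<comment> \<open>Here \<open>R - s\<close> is exactly \<open>2 * (2 + L) * d\<close>, and the
      denominator is lowered from \<open>R\<close> to \<open>\<rho> x\<close>.\<close>
    show "(R - s) / R \<le> 2 * (2 + L) * (d / \<rho> x)"
    proof -
      have "(R - s) / R \<le> (R - s) / \<rho> x"
        using R \<rho> by (intro divide_left_mono) auto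
      then show ?thesis
        by (simp add: R_def s_def algebra_simps add_divide_distrib)
    qed
  qed (use R D u in auto)
  also have "\<dots> = 4 * M * D * (2 * (2 + L)) powr \<delta> * (dist x y / \<rho> x) powr \<delta>"
    using \<rho> d by (subst powr_mult) (auto simp: d_def)
  finally show ?thesis .
qed

section \<open>Oscillation of the midrange\<close>

text \<open>Midpoint concavity of \<open>powr \<delta>\<close>, obtained from convexity of its
  inverse \<open>powr (1 / \<delta>)\<close> at \<open>a powr \<delta>\<close> and
  \<open>b powr \<delta>\<close>. If an argument vanishes, the claim reduces to
  \<open>2 powr \<delta> \<le> 2\<close>.\<close>

lemma powr_add_le_midpoint:
  fixes a b \<delta> :: real
  assumes "0 \<le> a" "0 \<le> b" "0 < \<delta>" "\<delta> \<le> 1"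
  shows "a powr \<delta> + b powr \<delta> \<le> 2 * ((a + b) / 2) powr \<delta>"
proof (cases "a = 0 \<or> b = 0")
  case True
  have "2 powr \<delta> \<le> (2::real) powr 1"
    using assms by (intro powr_mono) auto
  then have "c powr \<delta> \<le> 2 * (c / 2) powr \<delta>" if "0 \<le> c" for c :: real
    using that mult_right_mono[of "2 powr \<delta>" 2 "c powr \<delta>"] by (simp add: powr_divide field_simps)
  then show ?thesis
    using True assms by auto
next
  case False
  define m where "m = (a powr \<delta> + b powr \<delta>) / 2"
  have "0 < m"
    using False by (simp add: m_def add_pos_pos)
  have "((1 - 1/2) *\<^sub>R (a powr \<delta>) + (1/2) *\<^sub>R (b powr \<delta>)) powr (1 / \<delta>)
      \<le> (1 - 1/2) * (a powr \<delta>) powr (1 / \<delta>) + (1/2) * (b powr \<delta>) powr (1 / \<delta>)"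
    by (rule convex_onD[OF powr_convex]) (use False assms in auto)
  then have "m powr (1 / \<delta>) \<le> (a + b) / 2"
    using assms by (simp add: m_def powr_powr add_divide_distrib)
  then have "(m powr (1 / \<delta>)) powr \<delta> \<le> ((a + b) / 2) powr \<delta>"
    using assms by (intro powr_mono2) auto
  then show ?thesis
    using assms \<open>0 < m\<close> by (simp add: powr_powr m_def)
qed

text \<open>One of the radii grows and the other shrinks: the displacement of a maximum point and that of a
  minimum point add up to at most \<open>2 * L * dist x y\<close>, which the concavity of \<open>powr \<delta>\<close> exploits.\<close>

lemma midrange_op_diff_le:
  fixes x y :: "'a::metric_space"
  assumes geo: "geodesic_space TYPE('a)" and \<delta>: "0 < \<delta>" "\<delta> \<le> 1"
    and \<rho>: "0 \<le> \<rho> x" "0 \<le> \<rho> y" "\<bar>\<rho> x - \<rho> y\<bar> \<le> L * dist x y" "1 \<le> L"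
    and bdd: "bounded (u ` cball x (\<rho> x))" "bounded (u ` cball y (\<rho> y))"
    and osc: "\<And>z w. z \<in> cball x (\<rho> x) \<Longrightarrow> w \<in> cball y (\<rho> y) \<Longrightarrow> \<bar>u z - u w\<bar> \<le> a + b * dist z w powr \<delta>"
    and b: "0 \<le> b"
  shows "midrange_op \<rho> u x - midrange_op \<rho> u y \<le> a + b * (L * dist x y) powr \<delta>"
proof -
  \<comment> \<open>A point of the ball about \<open>x\<close> is within
    \<open>dist x y + \<rho> x\<close> of \<open>y\<close>, so it can be moved into the ball about
    \<open>y\<close> at cost at most \<open>h1\<close>; \<open>h2\<close> is the same with the roles
    exchanged. The value 0 occurs when one ball contains the other.\<close>
  define h1 where "h1 = max 0 (dist x y + (\<rho> x - \<rho> y))"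
  define h2 where "h2 = max 0 (dist x y - (\<rho> x - \<rho> y))"
  have Sup: "Sup (u ` cball x (\<rho> x)) \<le> Sup (u ` cball y (\<rho> y)) + (a + b * h1 powr \<delta>)"
  proof (rule cSup_least)
    fix q assume "q \<in> u ` cball x (\<rho> x)"
    then obtain z where z: "z \<in> cball x (\<rho> x)" "q = u z"
      by auto
    obtain w where w: "w \<in> cball y (\<rho> y)" "dist w z \<le> max 0 (dist y z - \<rho> y)"
      using geodesic_space_point_on_ball[OF geo \<rho>(2)] by blast
    have "dist y z - \<rho> y \<le> dist x y + (\<rho> x - \<rho> y)"
      using z dist_triangle[of y z x] by (simp add: dist_commute)
    then have "dist z w \<le> h1"
      using w unfolding h1_def by (simp add: dist_commute)
    then have "b * dist z w powr \<delta> \<le> b * h1 powr \<delta>"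
      using \<delta> b by (intro mult_left_mono powr_mono2) auto
    moreover have "u w \<le> Sup (u ` cball y (\<rho> y))"
      using w bdd by (intro cSup_upper bounded_imp_bdd_above) auto
    ultimately show "q \<le> Sup (u ` cball y (\<rho> y)) + (a + b * h1 powr \<delta>)"
      using osc[OF z(1) w(1)] z(2) by linarith
  qed (use \<rho> in auto)
  have Inf: "Inf (u ` cball x (\<rho> x)) - (a + b * h2 powr \<delta>) \<le> Inf (u ` cball y (\<rho> y))"
  proof (rule cInf_greatest)
    fix q assume "q \<in> u ` cball y (\<rho> y)"
    then obtain z where z: "z \<in> cball y (\<rho> y)" "q = u z"
      by auto
    obtain w where w: "w \<in> cball x (\<rho> x)" "dist w z \<le> max 0 (dist x z - \<rho> x)"
      using geodesic_space_point_on_ball[OF geo \<rho>(1)] by blast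
    have "dist x z - \<rho> x \<le> dist x y - (\<rho> x - \<rho> y)"
      using z dist_triangle[of x z y] by simp
    then have "dist w z \<le> h2"
      using w unfolding h2_def by simp
    then have "b * dist w z powr \<delta> \<le> b * h2 powr \<delta>"
      using \<delta> b by (intro mult_left_mono powr_mono2) auto
    moreover have "Inf (u ` cball x (\<rho> x)) \<le> u w"
      using w bdd by (intro cInf_lower bounded_imp_bdd_below) auto
    ultimately show "Inf (u ` cball x (\<rho> x)) - (a + b * h2 powr \<delta>) \<le> q"
      using osc[OF w(1) z(1)] z(2) by linarith
  qed (use \<rho> in auto)
  have "1 * dist x y \<le> L * dist x y"
    using \<rho> by (intro mult_right_mono) auto
  \<comment> \<open>If the radii differ by at most \<open>dist x y\<close>, the sum is
    \<open>2 * dist x y\<close>. Otherwise one summand is 0 and the other is at most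
    \<open>(1 + L) * dist x y\<close>. Both are at most \<open>2 * L * dist x y\<close> because
    \<open>L \<ge> 1\<close>.\<close>
  then have "(h1 + h2) / 2 \<le> L * dist x y"
    using \<rho>(3) unfolding h1_def h2_def by auto
  then have "((h1 + h2) / 2) powr \<delta> \<le> (L * dist x y) powr \<delta>"
    using \<delta> by (intro powr_mono2) (auto simp: h1_def h2_def)
  moreover have "h1 powr \<delta> + h2 powr \<delta> \<le> 2 * ((h1 + h2) / 2) powr \<delta>"
    using \<delta> by (intro powr_add_le_midpoint) (auto simp: h1_def h2_def)
  ultimately have "b * (h1 powr \<delta> + h2 powr \<delta>) \<le> b * (2 * (L * dist x y) powr \<delta>)"
    using b by (intro mult_left_mono) auto
  then have "b * h1 powr \<delta> + b * h2 powr \<delta> \<le> 2 * (b * (L * dist x y) powr \<delta>)"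
    by (simp add: algebra_simps)
  then show ?thesis
    using Sup Inf unfolding midrange_op_def by argo
qed

section \<open>Hoelder continuity by iterating the fixed point equation\<close>

theorem theorem5p1:
  fixes \<mu> :: "'a::metric_space measure"
    and \<Omega> :: "'a set" and \<rho> u :: "'a \<Rightarrow> real"
    and \<delta> L lam \<epsilon> \<beta> \<alpha> :: real
  assumes "proper_space TYPE('a)" and "geodesic_space TYPE('a)" and "mm_space \<mu>"
    and "0 < \<delta>" and "\<delta> \<le> 1" and "annular_decay \<mu> \<delta>"
    and "domain \<Omega>" and "bounded \<Omega>"
    and "admissible_radius \<Omega> \<rho>"
    and "L \<ge> 1" and "\<forall>x\<in>\<Omega>. \<forall>y\<in>\<Omega>. \<bar>\<rho> x - \<rho> y\<bar> \<le> L * dist x y"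
    and "\<forall>x\<in>\<Omega>. lam * infdist x (frontier \<Omega>) powr \<beta> \<le> \<rho> x \<and> \<rho> x \<le> \<epsilon> * infdist x (frontier \<Omega>)"
    and "0 < lam" and "lam \<le> inradius \<Omega> powr (1 - \<beta>) * \<epsilon>"
    and "\<bar>\<alpha>\<bar> < 1 / L" and "0 < \<epsilon>" and "\<epsilon> < 1 - L * \<bar>\<alpha>\<bar>"
    and "1 \<le> \<beta>"
    and "\<alpha> \<noteq> 0 \<Longrightarrow> \<beta> < ln (1 / (L * \<bar>\<alpha>\<bar>)) / ln (1 / (1 - \<epsilon>))"
    and "continuous_on (closure \<Omega>) u"
    and "\<forall>x\<in>\<Omega>. T_op \<alpha> \<mu> \<rho> u x = u x"
  shows "locally_holder_on \<delta> \<Omega> u"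
proof -
  define F where "F x = infdist x (frontier \<Omega>)" for x
  obtain D where D: "D \<ge> 1" and decay: "\<And>x r R. 0 < r \<Longrightarrow> r \<le> R \<Longrightarrow>
      measure \<mu> (ball x R - ball x r) \<le> D * ((R - r) / R) powr \<delta> * measure \<mu> (ball x R)"
    using assms(6) unfolding annular_decay_def by blast
  have \<rho>: "0 < \<rho> x" "\<rho> x \<le> F x" "\<rho> x \<le> \<epsilon> * F x" "lam * F x powr \<beta> \<le> \<rho> x" if "x \<in> \<Omega>" for x
    using assms(9,12) that unfolding admissible_radius_def F_def by auto
  have "0 \<le> L * \<bar>\<alpha>\<bar>"
    using assms(10) by simp
  then have \<epsilon>: "0 < \<epsilon>" "\<epsilon> < 1"
    using assms(16,17) by linarith+
  have "1 / L \<le> 1"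
    using assms(10) by simp
  then have \<alpha>: "\<bar>\<alpha>\<bar> < 1"
    using assms(15) by linarith
  \<comment> \<open>\<open>F\<close> is 1-Lipschitz and the radius is at most
    \<open>\<epsilon> * F x\<close>, so passing to a point of the ball costs at most the factor
    \<open>1 - \<epsilon>\<close>.\<close>
  have F_cball: "(1 - \<epsilon>) * F x \<le> F z" if "x \<in> \<Omega>" "z \<in> cball x (\<rho> x)" for x z
  proof -
    have "F x \<le> F z + dist x z"
      unfolding F_def by (rule infdist_triangle)
    then show ?thesis
      using \<rho>(3)[OF that(1)] that(2) by (simp add: algebra_simps)
  qed
  have cball: "cball x (\<rho> x) \<subseteq> \<Omega>" if "x \<in> \<Omega>" for x
  proof -
    have "\<epsilon> * F x < 1 * F x"
      using \<epsilon> \<rho>(1,2)[OF that] by (intro mult_strict_right_mono) auto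
    then have "\<rho> x < F x"
      using \<rho>(3)[OF that] by simp
    then show ?thesis
      unfolding F_def using geodesic_space_cball_subset assms(2) that by blast
  qed
  have "compact (closure \<Omega>)"
    using assms(1,8) closed_closure bounded_closure unfolding proper_space_def by blast
  then have "bounded (u ` closure \<Omega>)"
    using assms(20) by (intro compact_imp_bounded compact_continuous_image)
  then obtain M where "M > 0" and M: "\<And>z. z \<in> closure \<Omega> \<Longrightarrow> \<bar>u z\<bar> \<le> M"
    unfolding bounded_pos by auto
  have bdd: "bounded (u ` cball x (\<rho> x))" if "x \<in> \<Omega>" for x
    using \<open>bounded (u ` closure \<Omega>)\<close> cball[OF that] closure_subset[of \<Omega>]
    by (meson bounded_subset image_mono order.trans)

  \<comment> \<open>One iteration turns a Hoelder constant \<open>b\<close> into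
    \<open>q * b + C\<close>. In \<open>q\<close>, the factor \<open>L powr \<delta>\<close> comes
    from the midrange and the power of \<open>1 - \<epsilon>\<close> from approaching the frontier;
    \<open>C\<close> is the contribution of the mean, with \<open>lam\<close> from the lower bound
    on \<open>\<rho>\<close>. The value of \<open>b\<close> is the fixed point of this map.\<close>
  define q where "q = \<bar>\<alpha>\<bar> * L powr \<delta> * (1 - \<epsilon>) powr (- (\<beta> * \<delta>))"
  define C where "C = \<bar>1 - \<alpha>\<bar> * (4 * M * D * (2 * (2 + L)) powr \<delta>) * lam powr (- \<delta>)"
  define b where "b = C / (1 - q)"
  have "0 \<le> C"
    using \<open>M > 0\<close> D unfolding C_def by simp
  \<comment> \<open>The upper bound on \<open>\<beta>\<close> says exactly that
    \<open>\<bar>\<alpha>\<bar> * p < 1\<close> for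
    \<open>p = L * (1 - \<epsilon>) powr (- \<beta>)\<close>. Since \<open>p \<ge> 1\<close> and
    \<open>\<delta> \<le> 1\<close>, the factor \<open>p powr \<delta>\<close> in \<open>q\<close>
    is at most \<open>p\<close>.\<close>
  have "q < 1"
  proof (cases "\<alpha> = 0")
    case False
    define p where "p = L * (1 - \<epsilon>) powr (- \<beta>)"
    have "0 < L * \<bar>\<alpha>\<bar>"
      using False assms(10) by simp
    have "\<beta> < - ln (L * \<bar>\<alpha>\<bar>) / - ln (1 - \<epsilon>)"
      using assms(19)[OF False] \<epsilon> \<open>0 < L * \<bar>\<alpha>\<bar>\<close>
      by (simp only: inverse_eq_divide[symmetric] ln_inverse)
    moreover have "0 < - ln (1 - \<epsilon>)"
      using \<epsilon> by simp
    ultimately have "ln (L * \<bar>\<alpha>\<bar>) < \<beta> * ln (1 - \<epsilon>)"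
      by (simp only: pos_less_divide_eq)
    then have "exp (ln (L * \<bar>\<alpha>\<bar>)) < exp (\<beta> * ln (1 - \<epsilon>))"
      by (rule exp_less_mono)
    then have "L * \<bar>\<alpha>\<bar> < (1 - \<epsilon>) powr \<beta>"
      using \<epsilon> \<open>0 < L * \<bar>\<alpha>\<bar>\<close> by (simp only: exp_ln powr_def) auto
    then have "\<bar>\<alpha>\<bar> * p < 1"
      using \<epsilon> by (simp add: p_def powr_minus field_simps)
    have "1 * 1 \<le> p"
      unfolding p_def
    proof (intro mult_mono)
      have "(1 - \<epsilon>) powr \<beta> \<le> 1"
        using \<epsilon> assms(18) by (intro powr_le1) auto
      then show "1 \<le> (1 - \<epsilon>) powr (- \<beta>)"
        using \<epsilon> by (simp add: powr_minus one_le_inverse)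
    qed (use assms(10) in auto)
    then have "p powr \<delta> \<le> p powr 1"
      using assms(5) by (intro powr_mono) auto
    moreover have "q = \<bar>\<alpha>\<bar> * p powr \<delta>"
      using assms(10) \<epsilon> by (simp add: q_def p_def powr_mult powr_powr)
    ultimately have "q \<le> \<bar>\<alpha>\<bar> * p"
      using \<open>1 * 1 \<le> p\<close> by (simp add: mult_left_mono)
    then show ?thesis
      using \<open>\<bar>\<alpha>\<bar> * p < 1\<close> by linarith
  qed (simp add: q_def)
  then have "0 \<le> b" and b_eq: "q * b + C = b"
    using \<open>0 \<le> C\<close> by (auto simp: b_def field_simps)

  \<comment> \<open>The parameter \<open>t\<close> is a common lower bound for the distances of both
    points to the frontier. It is generalized in the induction because the previous bound is applied
    at level \<open>(1 - \<epsilon>) * t\<close>.\<close>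
  have main: "\<bar>u x - u y\<bar> \<le> \<bar>\<alpha>\<bar> ^ n * (2 * M) + b * t powr (- (\<beta> * \<delta>)) * dist x y powr \<delta>"
    if "x \<in> \<Omega>" "y \<in> \<Omega>" "0 < t" "t \<le> F x" "t \<le> F y" for n t x y
    using that
  proof (induction n arbitrary: x y t)
    case 0
    have "\<bar>u x\<bar> \<le> M" "\<bar>u y\<bar> \<le> M"
      using 0 M closure_subset[of \<Omega>] by auto
    moreover have "0 \<le> b * t powr (- (\<beta> * \<delta>)) * dist x y powr \<delta>"
      using \<open>0 \<le> b\<close> by simp
    ultimately show ?case
      by simp
  next
    case (Suc n)
    define A where "A = \<bar>\<alpha>\<bar> ^ n * (2 * M)"
    define h where "h = t powr (- (\<beta> * \<delta>)) * dist x y powr \<delta>"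
    show ?case
    proof (cases "x = y")
      case True
      then show ?thesis
        using \<open>M > 0\<close> \<open>0 \<le> b\<close> by simp
    next
      case False
      define B where "B = b * ((1 - \<epsilon>) * t) powr (- (\<beta> * \<delta>))"
      have "0 \<le> B"
        using \<open>0 \<le> b\<close> by (simp add: B_def)
      \<comment> \<open>Stated for arbitrary centres so that the one-sided midrange bound can be
        applied to \<open>x\<close>, \<open>y\<close> and to \<open>y\<close>, \<open>x\<close>,
        giving the absolute value.\<close>
      have osc: "\<bar>u z - u w\<bar> \<le> A + B * dist z w powr \<delta>"
        if "z \<in> cball x' (\<rho> x')" "w \<in> cball y' (\<rho> y')" "x' \<in> \<Omega>" "y' \<in> \<Omega>" "t \<le> F x'" "t \<le> F y'"
        for z w x' y'
        unfolding A_def B_def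
      proof (rule Suc.IH)
        show "z \<in> \<Omega>" "w \<in> \<Omega>"
          using cball that by blast+
        show "0 < (1 - \<epsilon>) * t"
          using \<epsilon> Suc.prems by simp
        have "(1 - \<epsilon>) * t \<le> (1 - \<epsilon>) * F x'" "(1 - \<epsilon>) * t \<le> (1 - \<epsilon>) * F y'"
          using \<epsilon> that by (auto intro!: mult_left_mono)
        then show "(1 - \<epsilon>) * t \<le> F z" "(1 - \<epsilon>) * t \<le> F w"
          using F_cball that by (meson order.trans)+
      qed
      have mid: "midrange_op \<rho> u x' - midrange_op \<rho> u y' \<le> A + B * (L * dist x' y') powr \<delta>"
        if "x' \<in> \<Omega>" "y' \<in> \<Omega>" "t \<le> F x'" "t \<le> F y'" for x' y'
        by (rule midrange_op_diff_le[OF assms(2,4,5) _ _ _ assms(10) bdd bdd osc[of _ x' _ y'] \<open>0 \<le> B\<close>])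
          (use that assms(11) \<rho>(1)[of x'] \<rho>(1)[of y'] in auto)
      have "\<bar>midrange_op \<rho> u x - midrange_op \<rho> u y\<bar> \<le> A + B * (L * dist x y) powr \<delta>"
        using mid[of x y] mid[of y x] Suc.prems by (simp add: dist_commute abs_le_iff)
      then have "\<bar>\<alpha>\<bar> * \<bar>midrange_op \<rho> u x - midrange_op \<rho> u y\<bar> \<le> \<bar>\<alpha>\<bar> * (A + B * (L * dist x y) powr \<delta>)"
        by (intro mult_left_mono) auto
      also have "\<dots> = \<bar>\<alpha>\<bar> * A + q * b * h"
        using assms(10) \<epsilon> Suc.prems by (simp add: B_def q_def h_def powr_mult distrib_left mult_ac)
      finally have mid_part: "\<bar>\<alpha> * (midrange_op \<rho> u x - midrange_op \<rho> u y)\<bar> \<le> \<bar>\<alpha>\<bar> * A + q * b * h"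
        by (simp add: abs_mult)
      have "\<bar>mean_op \<mu> \<rho> u x - mean_op \<mu> \<rho> u y\<bar>
          \<le> 4 * M * D * (2 * (2 + L)) powr \<delta> * (dist x y / \<rho> x) powr \<delta>"
        by (rule abs_mean_op_diff_le[OF assms(3) D assms(4) decay closed_closure assms(20) M])
          (use assms(10,11) \<open>M > 0\<close> \<rho>(1) Suc.prems False
            order.trans[OF cball closure_subset, of x] order.trans[OF cball closure_subset, of y] in auto)
      also have "\<dots> \<le> 4 * M * D * (2 * (2 + L)) powr \<delta> * (lam powr (- \<delta>) * h)"
      proof (intro mult_left_mono)
        have "lam * t powr \<beta> \<le> lam * F x powr \<beta>"
          using assms(13,18) Suc.prems by (intro mult_left_mono powr_mono2) auto
        then have "lam * t powr \<beta> \<le> \<rho> x"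
          using \<rho>(4) Suc.prems(1) by (meson order.trans)
        then have "(dist x y / \<rho> x) powr \<delta> \<le> (dist x y / (lam * t powr \<beta>)) powr \<delta>"
          using assms(4,13) Suc.prems \<rho>(1)[of x] by (intro powr_mono2 divide_left_mono) auto
        also have "\<dots> = lam powr (- \<delta>) * h"
          using assms(13) Suc.prems
          by (simp add: h_def powr_divide powr_mult powr_powr powr_minus field_simps)
        finally show "(dist x y / \<rho> x) powr \<delta> \<le> lam powr (- \<delta>) * h" .
      qed (use \<open>M > 0\<close> D in auto)
      finally have "\<bar>1 - \<alpha>\<bar> * \<bar>mean_op \<mu> \<rho> u x - mean_op \<mu> \<rho> u y\<bar>
          \<le> \<bar>1 - \<alpha>\<bar> * (4 * M * D * (2 * (2 + L)) powr \<delta> * (lam powr (- \<delta>) * h))"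
        by (intro mult_left_mono) auto
      then have mean_part: "\<bar>(1 - \<alpha>) * (mean_op \<mu> \<rho> u x - mean_op \<mu> \<rho> u y)\<bar> \<le> C * h"
        by (simp add: abs_mult C_def mult_ac)
      have "u x = T_op \<alpha> \<mu> \<rho> u x" "u y = T_op \<alpha> \<mu> \<rho> u y"
        using assms(21) Suc.prems by simp_all
      then have "u x - u y = \<alpha> * (midrange_op \<rho> u x - midrange_op \<rho> u y)
          + (1 - \<alpha>) * (mean_op \<mu> \<rho> u x - mean_op \<mu> \<rho> u y)"
        unfolding T_op_def by (simp add: algebra_simps)
      then have "\<bar>u x - u y\<bar> \<le> \<bar>\<alpha>\<bar> * A + (q * b + C) * h"
        using mid_part mean_part by (simp add: algebra_simps)
      then show ?thesis
        unfolding b_eq by (simp add: A_def h_def mult_ac)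
    qed
  qed

  \<comment> \<open>\<open>b\<close> and \<open>t\<close> do not depend on \<open>n\<close>, so
    letting \<open>n\<close> tend to infinity removes the constant term, as
    \<open>\<bar>\<alpha>\<bar> < 1\<close>.\<close>
  have limit: "\<bar>u x - u y\<bar> \<le> b * t powr (- (\<beta> * \<delta>)) * dist x y powr \<delta>"
    if "x \<in> \<Omega>" "y \<in> \<Omega>" "0 < t" "t \<le> F x" "t \<le> F y" for t x y
  proof (rule LIMSEQ_le_const)
    have "(\<lambda>n. \<bar>\<alpha>\<bar> ^ n * (2 * M) + b * t powr (- (\<beta> * \<delta>)) * dist x y powr \<delta>)
        \<longlonglongrightarrow> 0 * (2 * M) + b * t powr (- (\<beta> * \<delta>)) * dist x y powr \<delta>"
      using \<alpha> by (intro tendsto_intros LIMSEQ_power_zero) auto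
    then show "(\<lambda>n. \<bar>\<alpha>\<bar> ^ n * (2 * M) + b * t powr (- (\<beta> * \<delta>)) * dist x y powr \<delta>)
        \<longlonglongrightarrow> b * t powr (- (\<beta> * \<delta>)) * dist x y powr \<delta>"
      by simp
  qed (use main[OF that] in blast)
  show ?thesis
    unfolding locally_holder_on_def
  proof (intro allI impI)
    fix K assume K: "compact K \<and> K \<subseteq> \<Omega>"
    show "\<exists>C. \<forall>x\<in>K. \<forall>y\<in>K. \<bar>u x - u y\<bar> \<le> C * dist x y powr \<delta>"
    proof (cases "K = {}")
      case False
      \<comment> \<open>On a nonempty compact \<open>K\<close> the distance to the frontier attains
        a positive minimum \<open>F k\<close>, which serves as \<open>t\<close> for all pairs at
        once.\<close>
      have "continuous_on K F"
        unfolding F_def by (intro continuous_intros)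
      then obtain k where k: "k \<in> K" "\<And>x. x \<in> K \<Longrightarrow> F k \<le> F x"
        using continuous_attains_inf[of K F] K False by auto
      moreover have "0 < F k"
        using \<rho>(1,2)[of k] k K by fastforce
      ultimately show ?thesis
        using limit[of _ _ "F k"] K by blast
    qed simp
  qed
qed

end
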